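(* Let $S$ be an additively idempotent semiring. An ideal $I$ of $S$ is saturated if and only if it is a $k$-ideal.
   Context: A semiring is a commutative semiring $(S,+,0,\cdot,1)$ with multiplicative identity $1$ and additive identity $0$ that is absorbing. It is additively idempotent if $x+x=x$ for all $x$. An ideal is a nonempty subset closed under addition and under multiplication by elements of $S$. A $k$-ideal is an ideal $I$ such that $x+y\in I$ and $y\in I$ imply $x\in I$. An ideal $J$ is saturated if $J=\bar J$, where $\bar J:=\{x\in S: x+z=z \text{ for some } z\in J\}$. *)

theory Defs
  imports Main
begin

(* comm_semiring_1 is avoided as a base class because it excludes the trivial semiring (0 = 1). *)
class add_idem_semiring = comm_semiring_0 + comm_monoid_mult +
  assumes add_idem: "x + x = x"

definition semiring_ideal :: "'a::comm_semiring_0 set \<Rightarrow> bool" where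
  "semiring_ideal I \<longleftrightarrow> I \<noteq> {} \<and> (\<forall>x\<in>I. \<forall>y\<in>I. x + y \<in> I) \<and> (\<forall>s. \<forall>x\<in>I. s * x \<in> I)"

definition k_ideal :: "'a::comm_semiring_0 set \<Rightarrow> bool" where
  "k_ideal I \<longleftrightarrow> semiring_ideal I \<and> (\<forall>x y. x + y \<in> I \<and> y \<in> I \<longrightarrow> x \<in> I)"

definition saturation :: "'a::comm_semiring_0 set \<Rightarrow> 'a set" where
  "saturation J = {x. \<exists>z\<in>J. x + z = z}"

definition saturated :: "'a::comm_semiring_0 set \<Rightarrow> bool" where
  "saturated J \<longleftrightarrow> semiring_ideal J \<and> J = saturation J"

end

theory Submission
  imports Defs
begin

text \<open>By idempotence a sum absorbs each of its summands, so a sum lying in \<open>I\<close>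
  witnesses that its summands lie in the saturation. Conversely, \<open>x + z = z\<close> with
  \<open>z\<close> in \<open>I\<close> is an instance of the \<open>k\<close>-ideal
  condition.\<close>

theorem theorem6p22:
  fixes I :: "'a::add_idem_semiring set"
  assumes "semiring_ideal I"
  shows "saturated I \<longleftrightarrow> k_ideal I"
proof
  assume "saturated I"
  then have I: "I = saturation I"
    by (simp add: saturated_def)
  have "x \<in> I" if "x + y \<in> I" for x y
  proof -
    \<comment> \<open>The witness \<open>z\<close> is the sum \<open>x + y\<close> itself.\<close>
    have "x + (x + y) = x + y"
      by (simp add: add.assoc[symmetric] add_idem)
    with that have "x \<in> saturation I"
      unfolding saturation_def by blast
    with I show ?thesis by simp
  qed
  with assms show "k_ideal I"
    unfolding k_ideal_def by blast
next
  assume k: "k_ideal I"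
  \<comment> \<open>Each element is its own witness.\<close>
  have "I \<subseteq> saturation I"
    unfolding saturation_def using add_idem by blast
  moreover have "saturation I \<subseteq> I"
  proof
    fix x
    assume "x \<in> saturation I"
    then obtain z where "z \<in> I" "x + z = z"
      unfolding saturation_def by blast
    \<comment> \<open>Both \<open>x + z\<close>, being equal to \<open>z\<close>, and
      \<open>z\<close> lie in \<open>I\<close>.\<close>
    with k show "x \<in> I"
      unfolding k_ideal_def by metis
  qed
  ultimately show "saturated I"
    using assms by (simp add: saturated_def)
qed

end
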